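(* Let $\Gamma=(V,E)$ be a finite simple graph. An order-preserving map $g:P(\Gamma)^\top\to P(\Gamma)^\top$ is the induced cell map $\hat f$ of a continuous partial vertex function $f:V\to V$ if and only if it satisfies the following two conditions: (1) (Atom or Top Preservation) for every vertex cell $\{v\}\in P(\Gamma)$, its image $\{v\}g$ is either a singleton vertex cell $\{w\}\in P(\Gamma)$ or $\top$; (2) (Principal Fiber Condition) for every $C\in P(\Gamma)$, the preimage $(\downarrow C)g^{-1}=\{X\in P(\Gamma)^\top\mid Xg\le C\}$ is either empty or a principal down-set $\downarrow D$ for some cell $D\in P(\Gamma)$.
   Context: The face poset $P(\Gamma)$ is the set of all cells of $\Gamma$ (singletons $\{v\}$, $v\in V$, and edges $\{u,v\}\in E$) ordered by inclusion. A partial map $f:V\to V$ (acting on the right) is continuous if for every cell $C$ the full preimage $\{v\in\operatorname{Dom}(f)\mid vf\in C\}$ is a cell or empty. The extended poset is $P(\Gamma)^\top=P(\Gamma)\cup\{\top\}$ with $X\le\top$ for all $X$. The induced cell map $\hat f:P(\Gamma)^\top\to P(\Gamma)^\top$ is defined by: $\top\hat f=\top$; for a cell $C$, if $C\not\subseteq\operatorname{Dom}(f)$ then $C\hat f=\top$; if $C\subseteq\operatorname{Dom}(f)$ and the image set $Cf$ is a cell then $C\hat f=Cf$; if $C\subseteq\operatorname{Dom}(f)$ and $Cf$ is not a cell then $C\hat f=\top$. For a poset element $C$, $\downarrow C=\{X\mid X\le C\}$. *)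

theory Defs
  imports "HOL-Library.Lattice_Constructions" "HOL-Library.FuncSet"
begin

definition finite_simple_graph :: "'a set \<Rightarrow> 'a set set \<Rightarrow> bool" where
  "finite_simple_graph V E \<longleftrightarrow> finite V \<and> E \<subseteq> {{u, v} | u v. u \<in> V \<and> v \<in> V \<and> u \<noteq> v}"

definition face_poset :: "'a set \<Rightarrow> 'a set set \<Rightarrow> 'a set set" where
  "face_poset V E = {{v} | v. v \<in> V} \<union> E"

(* The order on the type 'a set top is inclusion with an extra greatest element
   adjoined; the extended poset is a finite subset of that type. The constructor
   names are qualified because flat_complete_lattice reuses them. *)
definition ext_face_poset :: "'a set \<Rightarrow> 'a set set \<Rightarrow> 'a set top set" where
  "ext_face_poset V E = insert top.Top (top.Value ` face_poset V E)"

definition down_set :: "'a set \<Rightarrow> 'a set set \<Rightarrow> 'a set top \<Rightarrow> 'a set top set" where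
  "down_set V E C = {X \<in> ext_face_poset V E. X \<le> C}"

definition partial_vertex_map :: "'a set \<Rightarrow> ('a \<rightharpoonup> 'a) \<Rightarrow> bool" where
  "partial_vertex_map V f \<longleftrightarrow> dom f \<subseteq> V \<and> ran f \<subseteq> V"

definition continuous_partial_map :: "'a set \<Rightarrow> 'a set set \<Rightarrow> ('a \<rightharpoonup> 'a) \<Rightarrow> bool" where
  "continuous_partial_map V E f \<longleftrightarrow> partial_vertex_map V f \<and>
     (\<forall>C \<in> face_poset V E.
        {v \<in> dom f. the (f v) \<in> C} \<in> face_poset V E \<or> {v \<in> dom f. the (f v) \<in> C} = {})"

definition induced_cell_map ::
    "'a set \<Rightarrow> 'a set set \<Rightarrow> ('a \<rightharpoonup> 'a) \<Rightarrow> 'a set top \<Rightarrow> 'a set top" where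
  "induced_cell_map V E f X = (case X of
       top.Top \<Rightarrow> top.Top
     | top.Value C \<Rightarrow>
         (if C \<subseteq> dom f \<and> (\<lambda>v. the (f v)) ` C \<in> face_poset V E
          then top.Value ((\<lambda>v. the (f v)) ` C) else top.Top))"

definition atom_or_top_preserving ::
    "'a set \<Rightarrow> 'a set set \<Rightarrow> ('a set top \<Rightarrow> 'a set top) \<Rightarrow> bool" where
  "atom_or_top_preserving V E g \<longleftrightarrow>
     (\<forall>v \<in> V. (\<exists>w \<in> V. g (top.Value {v}) = top.Value {w}) \<or> g (top.Value {v}) = top.Top)"

definition principal_fiber_condition ::
    "'a set \<Rightarrow> 'a set set \<Rightarrow> ('a set top \<Rightarrow> 'a set top) \<Rightarrow> bool" where
  "principal_fiber_condition V E g \<longleftrightarrow>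
     (\<forall>C \<in> face_poset V E.
        {X \<in> ext_face_poset V E. g X \<in> down_set V E (top.Value C)} = {} \<or>
        (\<exists>D \<in> face_poset V E.
           {X \<in> ext_face_poset V E. g X \<in> down_set V E (top.Value C)} = down_set V E (top.Value D)))"

end

theory Submission
  imports Defs
begin

text \<open>
  Two facts carry the proof: a nonempty subset of a cell is again a cell
  (lemma \<open>face_poset_nonempty_subset\<close>), and inclusion of cells can be tested on vertices.

  If \<open>f\<close> is continuous, then the cells whose image lies below \<open>C\<close> are exactly the cells
  contained in the set preimage of \<open>C\<close>, because a nonempty subset of \<open>C\<close> cannot fail to be a
  cell. Hence the fiber over \<open>C\<close> is the down-set of that preimage, or empty with it
  (lemma \<open>fiber_of_induced_cell_map\<close>).

  Conversely, atom or top preservation lets one read off a partial vertex map \<open>f\<close>, here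
  \<open>vertex_part V g\<close>, from the values of \<open>g\<close> on the vertices. Comparing vertices, the generator
  \<open>D\<close> of the fiber over \<open>C\<close> is the preimage of \<open>C\<close> under \<open>f\<close>, which gives continuity. That
  \<open>g\<close> is the cell map of \<open>f\<close> combines two bounds. Monotonicity bounds \<open>g X\<close> from below by the
  images of the vertices of \<open>X\<close>. The fiber condition bounds it from above: if the set image
  \<open>C\<close> of \<open>X\<close> is a cell, then the fiber over \<open>C\<close> contains all vertices of \<open>X\<close>, so its generator
  contains \<open>X\<close>, and therefore \<open>g X \<le> C\<close> (lemma \<open>cell_in_fiber_if_vertices_in_fiber\<close>). If the
  set image is not a cell, then \<open>g X = \<top>\<close>: a cell as value would, by the lower bound, contain
  the set image, which would then be a cell. The fiber condition also forces \<open>g \<top> = \<top>\<close>, as a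
  principal down-set generated by a cell does not contain \<open>\<top>\<close>.
\<close>

lemma face_poset_nonempty_subset:
  assumes "finite_simple_graph V E" "C \<in> face_poset V E" "A \<subseteq> C" "A \<noteq> {}"
  shows "A \<in> face_poset V E"
proof -
  from assms(1,2) obtain u v where C: "C = {u, v}" and uv: "u \<in> V" "v \<in> V"
    unfolding finite_simple_graph_def face_poset_def by blast
  from assms(3,4) C have "A = {u} \<or> A = {v} \<or> A = C" by blast
  with assms(2) uv show ?thesis by (auto simp: face_poset_def)
qed

lemma face_poset_subset:
  assumes "finite_simple_graph V E" "C \<in> face_poset V E"
  shows "C \<subseteq> V" and "C \<noteq> {}"
  using assms unfolding finite_simple_graph_def face_poset_def by blast+

lemma singleton_in_face_poset: "{v} \<in> face_poset V E" if "v \<in> V"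
  using that by (auto simp: face_poset_def)

lemma Value_in_ext_face_poset [simp]:
  "top.Value C \<in> ext_face_poset V E \<longleftrightarrow> C \<in> face_poset V E"
  by (auto simp: ext_face_poset_def)

lemma Top_in_ext_face_poset [simp]: "top.Top \<in> ext_face_poset V E"
  by (simp add: ext_face_poset_def)

lemma Value_in_down_set [simp]:
  "top.Value A \<in> down_set V E (top.Value C) \<longleftrightarrow> A \<in> face_poset V E \<and> A \<subseteq> C"
  by (simp add: down_set_def)

lemma Top_notin_down_set [simp]: "top.Top \<notin> down_set V E (top.Value C)"
  by (simp add: down_set_def)

lemma induced_cell_map_Top [simp]: "induced_cell_map V E f top.Top = top.Top"
  by (simp add: induced_cell_map_def)

lemma induced_cell_map_Value:
  "induced_cell_map V E f (top.Value C) =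
     (if C \<subseteq> dom f \<and> (\<lambda>v. the (f v)) ` C \<in> face_poset V E
      then top.Value ((\<lambda>v. the (f v)) ` C) else top.Top)"
  by (simp add: induced_cell_map_def)


section \<open>The cell map of a continuous partial map\<close>

lemma induced_cell_map_atom_or_top_preserving:
  assumes "partial_vertex_map V f"
  shows "atom_or_top_preserving V E (induced_cell_map V E f)"
  using assms
  by (auto simp: atom_or_top_preserving_def induced_cell_map_Value partial_vertex_map_def
      face_poset_def intro: ranI)

text \<open>
  The condition that the image be a cell, which is part of the definition of the cell map, is
  automatic below \<open>C\<close>; only the inclusion of \<open>X\<close> in the preimage of \<open>C\<close> remains.
\<close>

lemma fiber_of_induced_cell_map:
  assumes "finite_simple_graph V E" "C \<in> face_poset V E"
  shows "{X \<in> ext_face_poset V E. induced_cell_map V E f X \<in> down_set V E (top.Value C)} =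
         down_set V E (top.Value {v \<in> dom f. the (f v) \<in> C})" (is "?L = ?R")
proof (rule set_eqI)
  fix X
  show "X \<in> ?L \<longleftrightarrow> X \<in> ?R"
  proof (cases X)
    case (Value A)
    have "(\<lambda>v. the (f v)) ` A \<in> face_poset V E"
      if "A \<in> face_poset V E" "(\<lambda>v. the (f v)) ` A \<subseteq> C"
      using face_poset_nonempty_subset[OF assms that(2)] face_poset_subset[OF assms(1) that(1)]
      by blast
    then show ?thesis
      by (auto simp: Value induced_cell_map_Value split: if_splits)
  qed simp
qed

lemma induced_cell_map_principal_fiber_condition:
  assumes "finite_simple_graph V E" "continuous_partial_map V E f"
  shows "principal_fiber_condition V E (induced_cell_map V E f)"
  unfolding principal_fiber_condition_def
proof
  fix C assume C: "C \<in> face_poset V E"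
  let ?D = "{v \<in> dom f. the (f v) \<in> C}"
  have "down_set V E (top.Value {}) = {}"
  proof -
    have "X \<notin> down_set V E (top.Value {})" for X
      using face_poset_subset(2)[OF assms(1)] by (cases X) auto
    then show ?thesis by blast
  qed
  moreover have "?D \<in> face_poset V E \<or> ?D = {}"
    using assms(2) C by (simp add: continuous_partial_map_def)
  ultimately show "{X \<in> ext_face_poset V E.
        induced_cell_map V E f X \<in> down_set V E (top.Value C)} = {} \<or>
      (\<exists>D\<in>face_poset V E. {X \<in> ext_face_poset V E.
        induced_cell_map V E f X \<in> down_set V E (top.Value C)} = down_set V E (top.Value D))"
    unfolding fiber_of_induced_cell_map[OF assms(1) C] by metis
qed


section \<open>Recovering the vertex map\<close>

definition vertex_part :: "'a set \<Rightarrow> ('a set top \<Rightarrow> 'a set top) \<Rightarrow> ('a \<rightharpoonup> 'a)" where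
  "vertex_part V g v =
     (if v \<in> V \<and> (\<exists>w \<in> V. g (top.Value {v}) = top.Value {w})
      then Some (THE w. g (top.Value {v}) = top.Value {w}) else None)"

lemma vertex_part_eq_Some_iff:
  "vertex_part V g v = Some w \<longleftrightarrow> v \<in> V \<and> w \<in> V \<and> g (top.Value {v}) = top.Value {w}"
  by (auto simp: vertex_part_def)

lemma partial_vertex_map_vertex_part: "partial_vertex_map V (vertex_part V g)"
  by (auto simp: partial_vertex_map_def ran_def vertex_part_eq_Some_iff)

text \<open>
  This equivalence turns every question about fibers of \<open>g\<close>, asked on vertices, into one about
  preimages under its vertex part: a vertex sent to \<open>\<top>\<close> lies in no fiber over a cell.
\<close>

lemma vertex_in_fiber_iff:
  assumes "atom_or_top_preserving V E g" "v \<in> V"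
  shows "g (top.Value {v}) \<le> top.Value C \<longleftrightarrow>
         v \<in> dom (vertex_part V g) \<and> the (vertex_part V g v) \<in> C"
proof (cases "vertex_part V g v")
  case None
  have "g (top.Value {v}) = top.Top"
    using assms None unfolding atom_or_top_preserving_def
    by (metis option.distinct(1) vertex_part_eq_Some_iff)
  then show ?thesis by (simp add: None domIff)
next
  case (Some w)
  then have "g (top.Value {v}) = top.Value {w}" by (simp add: vertex_part_eq_Some_iff)
  then show ?thesis by (simp add: Some domIff)
qed

lemma principal_fiberE:
  assumes "principal_fiber_condition V E g" "C \<in> face_poset V E"
    and "g \<in> ext_face_poset V E \<rightarrow> ext_face_poset V E"
    and "X \<in> ext_face_poset V E" "g X \<le> top.Value C"
  obtains D where "D \<in> face_poset V E"
    and "\<And>Y. Y \<in> ext_face_poset V E \<Longrightarrow> g Y \<le> top.Value C \<longleftrightarrow> Y \<le> top.Value D"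
proof -
  have "X \<in> {X \<in> ext_face_poset V E. g X \<in> down_set V E (top.Value C)}"
    using assms by (auto simp: down_set_def)
  then obtain D where D: "D \<in> face_poset V E" and
    eq: "{X \<in> ext_face_poset V E. g X \<in> down_set V E (top.Value C)} = down_set V E (top.Value D)"
    using assms(1,2) unfolding principal_fiber_condition_def by blast
  have "g Y \<le> top.Value C \<longleftrightarrow> Y \<le> top.Value D" if "Y \<in> ext_face_poset V E" for Y
    using eq that assms(3) unfolding down_set_def by blast
  with D show thesis by (rule that)
qed

lemma continuous_vertex_part:
  assumes "finite_simple_graph V E" "g \<in> ext_face_poset V E \<rightarrow> ext_face_poset V E"
    and atom: "atom_or_top_preserving V E g" and fiber: "principal_fiber_condition V E g"
  shows "continuous_partial_map V E (vertex_part V g)"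
  unfolding continuous_partial_map_def
proof (intro conjI ballI partial_vertex_map_vertex_part)
  fix C assume C: "C \<in> face_poset V E"
  let ?f = "vertex_part V g"
  let ?A = "{v \<in> dom ?f. the (?f v) \<in> C}"
  have A: "v \<in> ?A \<longleftrightarrow> v \<in> V \<and> g (top.Value {v}) \<le> top.Value C" for v
    using vertex_in_fiber_iff[OF atom, of v C] partial_vertex_map_vertex_part[of V g]
    unfolding partial_vertex_map_def by blast
  show "?A \<in> face_poset V E \<or> ?A = {}"
  proof (cases "?A = {}")
    case False
    then obtain u where u: "u \<in> V" "g (top.Value {u}) \<le> top.Value C" using A by blast
    obtain D where D: "D \<in> face_poset V E" and
      le: "\<And>Y. Y \<in> ext_face_poset V E \<Longrightarrow> g Y \<le> top.Value C \<longleftrightarrow> Y \<le> top.Value D"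
      by (rule principal_fiberE[OF fiber C assms(2) _ u(2)])
        (use u(1) in \<open>simp_all add: singleton_in_face_poset\<close>)
    have "v \<in> ?A \<longleftrightarrow> v \<in> V \<and> v \<in> D" for v
      unfolding A using le[of "top.Value {v}"] by (auto simp: singleton_in_face_poset)
    then have "?A = D" using face_poset_subset(1)[OF assms(1) D] by blast
    with D show ?thesis by simp
  qed simp
qed

lemma principal_fiber_condition_Top:
  assumes "g \<in> ext_face_poset V E \<rightarrow> ext_face_poset V E" "principal_fiber_condition V E g"
  shows "g top.Top = top.Top"
proof (cases "g top.Top")
  case (Value C)
  have "C \<in> face_poset V E"
    using funcset_mem[OF assms(1) Top_in_ext_face_poset] Value by simp
  then obtain D where
    "\<And>Y. Y \<in> ext_face_poset V E \<Longrightarrow> g Y \<le> top.Value C \<longleftrightarrow> Y \<le> top.Value D"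
    by (rule principal_fiberE[OF assms(2) _ assms(1) Top_in_ext_face_poset]) (simp_all add: Value)
  from this[of top.Top] show ?thesis by (simp add: Value)
qed

lemma image_vertex_part_subset:
  assumes "finite_simple_graph V E" "mono_on (ext_face_poset V E) g"
    and "atom_or_top_preserving V E g"
    and "A \<in> face_poset V E" "g (top.Value A) = top.Value C"
  shows "A \<subseteq> dom (vertex_part V g)" and "(\<lambda>v. the (vertex_part V g v)) ` A \<subseteq> C"
proof -
  have "v \<in> dom (vertex_part V g) \<and> the (vertex_part V g v) \<in> C" if "v \<in> A" for v
  proof -
    have v: "v \<in> V" using face_poset_subset(1)[OF assms(1,4)] that by blast
    have "g (top.Value {v}) \<le> g (top.Value A)"
      by (rule mono_onD[OF assms(2)]) (use v that assms(4) in \<open>simp_all add: singleton_in_face_poset\<close>)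
    then show ?thesis using vertex_in_fiber_iff[OF assms(3) v] assms(5) by simp
  qed
  then show "A \<subseteq> dom (vertex_part V g)" "(\<lambda>v. the (vertex_part V g v)) ` A \<subseteq> C" by blast+
qed

text \<open>
  A cell that contains every vertex of \<open>A\<close> contains \<open>A\<close>. So once the vertices of \<open>A\<close> are in the
  fiber over \<open>C\<close>, the fiber, being a principal down-set, cannot miss \<open>A\<close> itself. This is
  where the fiber condition prevents \<open>g\<close> from sending an edge to \<open>\<top>\<close>, or to an edge properly
  containing the image of its vertices.
\<close>

lemma cell_in_fiber_if_vertices_in_fiber:
  assumes "finite_simple_graph V E" "g \<in> ext_face_poset V E \<rightarrow> ext_face_poset V E"
    and "atom_or_top_preserving V E g" "principal_fiber_condition V E g"
    and A: "A \<in> face_poset V E" and C: "C \<in> face_poset V E"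
    and "A \<subseteq> dom (vertex_part V g)" "(\<lambda>v. the (vertex_part V g v)) ` A \<subseteq> C"
  shows "g (top.Value A) \<le> top.Value C"
proof -
  have vert: "v \<in> V" "g (top.Value {v}) \<le> top.Value C" if "v \<in> A" for v
  proof -
    show "v \<in> V" using face_poset_subset(1)[OF assms(1) A] that by blast
    then show "g (top.Value {v}) \<le> top.Value C"
      using vertex_in_fiber_iff[OF assms(3), of v C] subsetD[OF assms(7) that]
        subsetD[OF assms(8) imageI[OF that]] by blast
  qed
  obtain u where u: "u \<in> A" using face_poset_subset(2)[OF assms(1) A] by blast
  obtain D where
    le: "\<And>Y. Y \<in> ext_face_poset V E \<Longrightarrow> g Y \<le> top.Value C \<longleftrightarrow> Y \<le> top.Value D"
    by (rule principal_fiberE[OF assms(4) C assms(2) _ vert(2)[OF u]])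
      (use vert(1)[OF u] in \<open>simp_all add: singleton_in_face_poset\<close>)
  have "v \<in> D" if "v \<in> A" for v
    using le[of "top.Value {v}"] vert[OF that] by (simp add: singleton_in_face_poset)
  then show ?thesis using le[of "top.Value A"] A by auto
qed

lemma eq_induced_cell_map_vertex_part:
  assumes "finite_simple_graph V E" "g \<in> ext_face_poset V E \<rightarrow> ext_face_poset V E"
    and "mono_on (ext_face_poset V E) g"
    and "atom_or_top_preserving V E g" "principal_fiber_condition V E g"
    and X: "X \<in> ext_face_poset V E"
  shows "g X = induced_cell_map V E (vertex_part V g) X"
proof (cases X)
  case Top
  then show ?thesis by (simp add: principal_fiber_condition_Top[OF assms(2,5)])
next
  case (Value A)
  with X have A: "A \<in> face_poset V E" by simp
  let ?f = "vertex_part V g"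
  let ?B = "(\<lambda>v. the (?f v)) ` A"
  have lower: "A \<subseteq> dom ?f \<and> ?B \<subseteq> C" if "g (top.Value A) = top.Value C" for C
    using image_vertex_part_subset[OF assms(1,3,4) A that] by blast
  show ?thesis
  proof (cases "A \<subseteq> dom ?f \<and> ?B \<in> face_poset V E")
    case True
    then have "g (top.Value A) \<le> top.Value ?B"
      using cell_in_fiber_if_vertices_in_fiber[OF assms(1,2,4,5) A] by blast
    then obtain C where C: "g (top.Value A) = top.Value C" "C \<subseteq> ?B"
      by (cases "g (top.Value A)") auto
    then have "C = ?B" using lower by blast
    with C True show ?thesis by (simp add: Value induced_cell_map_Value)
  next
    case False
    have "g (top.Value A) = top.Top"
    proof (cases "g (top.Value A)")
      case (Value C)
      have "C \<in> face_poset V E" using funcset_mem[OF assms(2) X] \<open>X = _\<close> Value by simp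
      moreover have "?B \<noteq> {}" using face_poset_subset(2)[OF assms(1) A] by simp
      ultimately have "?B \<in> face_poset V E"
        using face_poset_nonempty_subset[OF assms(1)] lower[OF Value] by blast
      with False lower[OF Value] show ?thesis by blast
    qed
    with False show ?thesis by (auto simp: Value induced_cell_map_Value)
  qed
qed

theorem theorem20p5:
  fixes V :: "'a set" and E :: "'a set set" and g :: "'a set top \<Rightarrow> 'a set top"
  assumes "finite_simple_graph V E"
    and "g \<in> ext_face_poset V E \<rightarrow> ext_face_poset V E"
    and "mono_on (ext_face_poset V E) g"
  shows "(\<exists>f. continuous_partial_map V E f \<and>
            (\<forall>X \<in> ext_face_poset V E. g X = induced_cell_map V E f X)) \<longleftrightarrow>
         atom_or_top_preserving V E g \<and> principal_fiber_condition V E g"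
proof
  assume "\<exists>f. continuous_partial_map V E f \<and>
            (\<forall>X \<in> ext_face_poset V E. g X = induced_cell_map V E f X)"
  then obtain f where f: "continuous_partial_map V E f"
    and g: "\<And>X. X \<in> ext_face_poset V E \<Longrightarrow> g X = induced_cell_map V E f X" by blast
  have g_vertex: "g (top.Value {v}) = induced_cell_map V E f (top.Value {v})" if "v \<in> V" for v
    by (rule g) (simp add: that singleton_in_face_poset)
  have "partial_vertex_map V f" using f by (simp add: continuous_partial_map_def)
  then have "atom_or_top_preserving V E g"
    using induced_cell_map_atom_or_top_preserving[of V f E]
    by (simp add: atom_or_top_preserving_def g_vertex)
  moreover have "{X \<in> ext_face_poset V E. g X \<in> S} =
      {X \<in> ext_face_poset V E. induced_cell_map V E f X \<in> S}" for S
    by (rule Collect_cong) (metis g)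
  then have "principal_fiber_condition V E g"
    using induced_cell_map_principal_fiber_condition[OF assms(1) f]
    by (simp add: principal_fiber_condition_def)
  ultimately show "atom_or_top_preserving V E g \<and> principal_fiber_condition V E g" ..
next
  assume "atom_or_top_preserving V E g \<and> principal_fiber_condition V E g"
  then show "\<exists>f. continuous_partial_map V E f \<and>
            (\<forall>X \<in> ext_face_poset V E. g X = induced_cell_map V E f X)"
    using continuous_vertex_part[OF assms(1,2)] eq_induced_cell_map_vertex_part[OF assms]
    by blast
qed

end
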